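(* Let $G=(V,E)$ be an arbitrary finite network in which every node has at least one neighbor, let $f$ be a Type IV combat-power function, and consider the Type IV dynamics $$\frac{d}{dt}B_v(t)=f\Big(\frac{1}{\deg(v)}\sum_{u\in N_v}B_u(t)\Big)-B_v(t),\quad v\in V,$$ with state space $[0,1]^V$. (i) If $B_v(0)<1$ for all $v\in V$, then $\lim_{t\to\infty}B_v(t)=0$ for all $v\in V$. (ii) The equilibrium $[0,\dots,0]$ is asymptotically stable with exponential convergence. (iii) The equilibrium $[1,\dots,1]$ is unstable.
   Context: $G=(V,E)$ is a finite graph (undirected or directed) without self-loops, $N_v=\{u\in V:(u,v)\in E\}$ is the set of (in-)neighbors of $v$, and $\deg(v)=|N_v|$. A Type IV combat-power function is a function $f:[0,1]\to[0,1]$ that is convex, continuous and increasing on $[0,1]$, with $f(0)=0$, $f(1)=1$ and $f(x)<x$ for $x\in(0,1)$. $B_v(t)\in[0,1]$ represents the probability that node $v$ is secure at time $t$. An equilibrium $B^*$ is (asymptotically) stable if there is a neighborhood of $B^*$ in $[0,1]^V$ such that every trajectory $B(t)$ initially located in the neighborhood converges to $B^*$; it is stable with exponential convergence if moreover for each trajectory $B(t)$ starting in the neighborhood there exist constants $\varrho>0$ and $M>0$ such that $\|B(t)-B^*\|\le Me^{-\varrho t}$ for all $t\ge0$. Unstable means not stable. *)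

theory Defs
  imports "HOL-Analysis.Analysis"
begin

text \<open>
  \<^const>\<open>mono_on\<close> is monotonicity in the weak sense: a combat-power function is allowed to
  vanish on an initial segment of the unit interval.  Outside the unit interval \<^term>\<open>f\<close> is
  unconstrained.
\<close>

definition type_IV_combat_power :: "(real \<Rightarrow> real) \<Rightarrow> bool" where
  "type_IV_combat_power f \<longleftrightarrow>
     f \<in> {0..1} \<rightarrow> {0..1} \<and>
     convex_on {0..1} f \<and> continuous_on {0..1} f \<and> mono_on {0..1} f \<and>
     f 0 = 0 \<and> f 1 = 1 \<and> (\<forall>x\<in>{0<..<1}. f x < x)"

text \<open>
  The vertex set is the finite (hence nonempty) type \<^typ>\<open>'v\<close>.  An undirected graph is given by a
  symmetric relation.
\<close>

definition in_neighbors :: "('v \<times> 'v) set \<Rightarrow> 'v \<Rightarrow> 'v set" where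
  "in_neighbors E v = {u. (u, v) \<in> E}"

definition state_space :: "(real ^ 'v) set" where
  "state_space = {x. \<forall>v. x $ v \<in> {0..1}}"

definition type_IV_field ::
  "('v::finite \<times> 'v) set \<Rightarrow> (real \<Rightarrow> real) \<Rightarrow> real ^ 'v \<Rightarrow> real ^ 'v" where
  "type_IV_field E f x =
     (\<chi> v. f (1 / real (card (in_neighbors E v)) * (\<Sum>u\<in>in_neighbors E v. x $ u)) - x $ v)"

text \<open>
  The remaining notions concern the autonomous system \<^term>\<open>x' = F x\<close> on a state space \<^term>\<open>S\<close>.
  A trajectory is a global forward solution inside \<^term>\<open>S\<close>, with a one-sided derivative at
  time 0.  No uniqueness is presupposed: \<^term>\<open>F\<close> need not be Lipschitz (a combat-power function
  may have infinite slope at 1), and stability quantifies over all trajectories.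
\<close>

definition trajectory ::
  "'a::real_normed_vector set \<Rightarrow> ('a \<Rightarrow> 'a) \<Rightarrow> (real \<Rightarrow> 'a) \<Rightarrow> bool" where
  "trajectory S F B \<longleftrightarrow>
     (\<forall>t\<ge>0. B t \<in> S \<and> (B has_vector_derivative F (B t)) (at t within {0..}))"

definition equilibrium ::
  "'a::real_normed_vector set \<Rightarrow> ('a \<Rightarrow> 'a) \<Rightarrow> 'a \<Rightarrow> bool" where
  "equilibrium S F b \<longleftrightarrow> b \<in> S \<and> F b = 0"

text \<open>
  Asymptotic stability here means local attractivity only; Lyapunov stability is not part of it.
\<close>

definition asymptotically_stable ::
  "'a::real_normed_vector set \<Rightarrow> ('a \<Rightarrow> 'a) \<Rightarrow> 'a \<Rightarrow> bool" where
  "asymptotically_stable S F b \<longleftrightarrow>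
     (\<exists>U. openin (top_of_set S) U \<and> b \<in> U \<and>
          (\<forall>B. trajectory S F B \<and> B 0 \<in> U \<longrightarrow> (B \<longlongrightarrow> b) at_top))"

definition exponentially_stable ::
  "'a::real_normed_vector set \<Rightarrow> ('a \<Rightarrow> 'a) \<Rightarrow> 'a \<Rightarrow> bool" where
  "exponentially_stable S F b \<longleftrightarrow>
     (\<exists>U. openin (top_of_set S) U \<and> b \<in> U \<and>
          (\<forall>B. trajectory S F B \<and> B 0 \<in> U \<longrightarrow>
             (B \<longlongrightarrow> b) at_top \<and>
             (\<exists>\<rho>>0. \<exists>M>0. \<forall>t\<ge>0. norm (B t - b) \<le> M * exp (- \<rho> * t))))"

end

theory Submission
  imports Defs
begin

text \<open>
  If all coordinates start below \<^term>\<open>c < 1\<close>, convexity gives \<^term>\<open>f x \<le> (f c / c) * x\<close> on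
  \<^term>\<open>{0..c}\<close> with \<^term>\<open>f c / c < 1\<close>, so for small \<^term>\<open>r > 0\<close> the function
  \<^term>\<open>\<lambda>t. c * exp (- r * t)\<close> is a strict supersolution: at the first time a coordinate touches
  it, that coordinate would decrease faster than the barrier.  This yields (i) and (ii) at once.
  For (iii) a trajectory leaving the neighbourhood of \<^term>\<open>\<chi> v. 1\<close> has to be exhibited; the
  diagonal is invariant, and there \<^term>\<open>y' = f y - y\<close> is solved by separation of variables.  This
  needs no Lipschitz condition, and the solution is global because \<^term>\<open>y - f y \<le> y\<close>.
\<close>

section \<open>Decay below an exponential barrier\<close>

lemma type_IV_combat_powerD:
  assumes "type_IV_combat_power f"
  shows "convex_on {0..1} f" "continuous_on {0..1} f" "mono_on {0..1} f" "f 0 = 0" "f 1 = 1"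
    "\<And>x. 0 \<le> x \<Longrightarrow> x \<le> 1 \<Longrightarrow> 0 \<le> f x" "\<And>x. 0 < x \<Longrightarrow> x < 1 \<Longrightarrow> f x < x"
  using assms unfolding type_IV_combat_power_def by (auto simp: Pi_iff)

text \<open>The point \<open>x\<close> is the convex combination of \<open>0\<close> and
  \<open>c\<close> with weight \<open>x / c\<close> on \<open>c\<close>, and \<open>f 0 = 0\<close>
  removes the other term.\<close>

lemma convex_on_le_chord_through_0:
  fixes f :: "real \<Rightarrow> real"
  assumes "convex_on {0..1} f" "f 0 = 0" "0 < c" "c \<le> 1" "0 \<le> x" "x \<le> c"
  shows "f x \<le> f c / c * x"
proof -
  have "f ((1 - x / c) *\<^sub>R 0 + (x / c) *\<^sub>R c) \<le> (1 - x / c) * f 0 + (x / c) * f c"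
    by (rule convex_onD[OF assms(1)]) (use assms in auto)
  then show ?thesis using assms by (simp add: field_simps)
qed

lemma average_le:
  fixes g :: "'a \<Rightarrow> real"
  assumes "finite A" "A \<noteq> {}" "\<And>u. u \<in> A \<Longrightarrow> g u \<le> w"
  shows "1 / real (card A) * sum g A \<le> w"
proof -
  have "sum g A \<le> real (card A) * w" using sum_bounded_above[OF assms(3)] by simp
  moreover have "real (card A) > 0" using assms by (simp add: card_gt_0_iff)
  ultimately show ?thesis by (simp add: field_simps)
qed

lemma trajectory_component:
  assumes "trajectory state_space (type_IV_field E f) B" "0 \<le> t"
  shows "0 \<le> B t $ v" "B t $ v \<le> 1"
    "((\<lambda>t. B t $ v) has_real_derivative
       f (1 / real (card (in_neighbors E v)) * (\<Sum>u\<in>in_neighbors E v. B t $ u)) - B t $ v)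
       (at t within {0..})"
proof -
  have *: "B t \<in> state_space" "(B has_vector_derivative type_IV_field E f (B t)) (at t within {0..})"
    using assms unfolding trajectory_def by auto
  show "0 \<le> B t $ v" "B t $ v \<le> 1" using *(1) unfolding state_space_def by auto
  have "((\<lambda>t. B t $ v) has_vector_derivative type_IV_field E f (B t) $ v) (at t within {0..})"
    by (rule bounded_linear.has_vector_derivative[OF bounded_linear_vec_nth *(2)])
  then show "((\<lambda>t. B t $ v) has_real_derivative
       f (1 / real (card (in_neighbors E v)) * (\<Sum>u\<in>in_neighbors E v. B t $ u)) - B t $ v)
       (at t within {0..})"
    by (simp add: has_real_derivative_iff_has_vector_derivative type_IV_field_def)
qed

text \<open>A first-touching argument against the barrier \<open>c * exp (- r * t)\<close>. The rate
  depends only on \<open>c\<close> and \<open>f\<close>, so it serves all trajectories starting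
  below \<open>c\<close>.\<close>

lemma trajectory_exponential_decay:
  fixes E :: "('v::finite \<times> 'v) set" and f :: "real \<Rightarrow> real"
  assumes nb: "\<And>v. in_neighbors E v \<noteq> {}"
    and f: "type_IV_combat_power f"
    and c: "0 < c" "c < 1"
  shows "\<exists>r>0. \<forall>B. trajectory state_space (type_IV_field E f) B \<and> (\<forall>v. B 0 $ v < c) \<longrightarrow>
           (\<forall>t\<ge>0. \<forall>v. B t $ v \<le> c * exp (- r * t))"
proof -
  note fD = type_IV_combat_powerD[OF f]
  define k where "k = f c / c"
  have k1: "k < 1" using fD(7)[OF c] c by (simp add: k_def)
  \<comment> \<open>Any rate strictly between \<open>0\<close> and \<open>1 - k\<close> would do.
    Strictness makes the derivative at the touching time negative.\<close>
  define r where "r = (1 - k) / 2"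
  have r: "r > 0" "k - 1 < - r" using k1 by (auto simp: r_def field_simps)
  have "B t $ v \<le> c * exp (- r * t)"
    if B: "trajectory state_space (type_IV_field E f) B" and B0: "\<And>v. B 0 $ v < c"
      and t: "0 \<le> t" for B t v
  proof (rule ccontr)
    assume neg: "\<not> B t $ v \<le> c * exp (- r * t)"
    define w where "w t = c * exp (- r * t)" for t
    define h where "h v t = B t $ v - w t" for v t
    note comp = trajectory_component[OF B]
    have w': "(w has_real_derivative - r * w s) (at s within {0..})" for s
      unfolding w_def by (auto intro!: derivative_eq_intros)
    have conth: "continuous_on {0..t} (h u)" for u
    proof -
      have "continuous_on {0..} (\<lambda>t. B t $ u)"
        by (rule DERIV_continuous_on) (use comp(3) in auto)
      then have "continuous_on {0..} (h u)"
        unfolding h_def w_def by (rule continuous_on_diff) (intro continuous_intros)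
      then show ?thesis by (rule continuous_on_subset) auto
    qed
    \<comment> \<open>\<open>Z\<close> collects the times at which some coordinate is on or above
      the barrier. As a finite union of closed sets it is closed, so it contains its infimum, the
      first touching time \<open>s\<close>.\<close>
    define Z where "Z = (\<Union>u. {s\<in>{0..t}. 0 \<le> h u s})"
    have "closed {s\<in>{0..t}. 0 \<le> h u s}" for u
      by (rule continuous_on_closed_Collect_le) (auto intro: conth continuous_intros)
    then have "closed Z" unfolding Z_def by (intro closed_UN) auto
    moreover have "t \<in> Z"
      unfolding Z_def by (rule UN_I[of v]) (use neg t in \<open>auto simp: h_def w_def\<close>)
    then have "Z \<noteq> {}" by blast
    moreover have bdd: "bdd_below Z" unfolding Z_def by (auto intro!: bdd_belowI[of _ 0])
    ultimately have "Inf Z \<in> Z" by (intro closed_contains_Inf)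
    define s where "s = Inf Z"
    from \<open>Inf Z \<in> Z\<close> have "s \<in> Z" by (simp only: s_def)
    then obtain u where s: "0 \<le> s" "s \<le> t" "0 \<le> h u s" unfolding Z_def by auto
    have before: "h v x < 0" if "0 \<le> x" "x < s" for x v
    proof (rule ccontr)
      assume "\<not> h v x < 0"
      then have "x \<in> Z" unfolding Z_def by (intro UN_I[of v]) (use that s in auto)
      then show False using cInf_lower[OF _ bdd, of x] that by (simp add: s_def)
    qed
    have "h u 0 < 0" using B0 unfolding h_def w_def by simp
    then have s0: "0 < s" using s by (cases "s = 0") auto
    \<comment> \<open>Strict negativity before \<open>s\<close> passes to the limit from the left,
      so at time \<open>s\<close> no coordinate exceeds the barrier. Hence the average
      \<open>a\<close> over the neighbors of \<open>u\<close> is at most \<open>w s\<close>.\<close>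
    have at_s: "h v s \<le> 0" for v
    proof (rule continuous_le_on_closure[of "{0..<s}" "h v"])
      show "continuous_on (closure {0..<s}) (h v)"
        by (rule continuous_on_subset[OF conth]) (use s s0 in auto)
    qed (use s0 before in \<open>auto intro: less_imp_le\<close>)
    have hu: "B s $ u = w s" using at_s[of u] s(3) unfolding h_def by simp
    have w: "0 < w s" "w s \<le> c" using c r(1) s(1) unfolding w_def by (auto intro!: mult_left_le)
    define a where "a = 1 / real (card (in_neighbors E u)) * (\<Sum>x\<in>in_neighbors E u. B s $ x)"
    have a: "0 \<le> a" "a \<le> w s"
    proof -
      show "0 \<le> a" unfolding a_def using comp(1)[OF s(1)] by (intro mult_nonneg_nonneg sum_nonneg) auto
      show "a \<le> w s" unfolding a_def
        by (rule average_le) (use nb at_s in \<open>auto simp: h_def\<close>)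
    qed
    have "f a \<le> k * a"
      unfolding k_def by (rule convex_on_le_chord_through_0) (use fD c a w in auto)
    also have "\<dots> \<le> k * w s"
      using a fD(6)[of c] c unfolding k_def by (intro mult_left_mono) auto
    also have "\<dots> < (1 - r) * w s" using w r by simp
    finally have neg': "f a - B s $ u - (- r * w s) < 0" using hu by (simp add: algebra_simps)
    have "(h u has_real_derivative f a - B s $ u - (- r * w s)) (at s within {0..})"
      unfolding h_def a_def by (intro DERIV_diff comp(3) w' s(1))
    \<comment> \<open>A negative slope at \<open>s\<close> makes \<open>h u\<close> positive just
      before \<open>s\<close>, against the choice of \<open>s\<close>. The step
      \<open>min (d / 2) s\<close> does not go back beyond time 0.\<close>
    from has_real_derivative_neg_dec_left[OF this neg'] obtain d where d: "d > 0"
      "\<And>x. x > 0 \<Longrightarrow> s - x \<in> {0..} \<Longrightarrow> x < d \<Longrightarrow> h u s < h u (s - x)" by blast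
    have "h u s < h u (s - min (d / 2) s)" by (rule d(2)) (use d(1) s0 in auto)
    also have "\<dots> < 0" by (rule before) (use d(1) s0 in auto)
    finally show False using s(3) by simp
  qed
  then show ?thesis using r(1) by blast
qed

section \<open>Separation of variables for a scalar equation\<close>

lemma separable_ode_solution:
  fixes g :: "real \<Rightarrow> real"
  assumes cont: "continuous_on {0<..<1} g"
    and pos: "\<And>x. x \<in> {0<..<1} \<Longrightarrow> 0 < g x"
    and le: "\<And>x. x \<in> {0<..<1} \<Longrightarrow> g x \<le> x"
    and c: "c \<in> {0<..<1}"
  shows "\<exists>y. y 0 = c \<and> (\<forall>t\<ge>0. y t \<in> {0<..<1} \<and> (y has_real_derivative - g (y t)) (at t))"
proof -
  \<comment> \<open>The integral of \<open>1 / g\<close> starts strictly below 1, since nothing is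
    assumed about \<open>g\<close> at 1 and \<open>1 / g\<close> may fail to be integrable up to
    there.\<close>
  define d where "d = (c + 1) / 2"
  have d: "c < d" "d < 1" "0 < d" using c by (auto simp: d_def)
  \<comment> \<open>\<open>T x\<close> is the time a solution of \<open>y' = - g y\<close> takes to
    fall from \<open>d\<close> to \<open>x\<close>; the solution sought is the inverse of
    \<open>T\<close>, shifted in time.\<close>
  define T where "T x = integral {x..d} (\<lambda>x. 1 / g x)" for x
  have cont': "continuous_on {0<..<1} (\<lambda>x. 1 / g x)"
    using pos by (intro continuous_intros cont) force
  have T': "(T has_real_derivative - (1 / g x)) (at x)" if x: "x \<in> {0<..<d}" for x
  proof -
    have "continuous_on {x/2..d} (\<lambda>x. 1 / g x)"
      by (rule continuous_on_subset[OF cont']) (use x d in auto)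
    then have "(T has_vector_derivative - (1 / g x)) (at x within {x/2..d})"
      unfolding T_def by (rule integral_has_vector_derivative') (use x in auto)
    moreover have "at x within {x/2..d} = at x"
      by (rule at_within_interior) (use x in auto)
    ultimately show ?thesis by (simp add: has_real_derivative_iff_has_vector_derivative)
  qed
  have Tdec: "T y < T x" if "0 < x" "x < y" "y < d" for x y
  proof (rule DERIV_neg_imp_decreasing[OF that(2)])
    fix z assume "x \<le> z" "z \<le> y"
    then have "z \<in> {0<..<d}" using that by auto
    moreover from this have "g z > 0" using pos d by auto
    ultimately show "\<exists>l. (T has_real_derivative l) (at z) \<and> l < 0"
      using T' by (intro exI[of _ "- (1 / g z)"]) auto
  qed
  have T_inj: "x = y" if "x \<in> {0<..<d}" "y \<in> {0<..<d}" "T x = T y" for x y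
    using Tdec[of x y] Tdec[of y x] that by (cases x y rule: linorder_cases) auto
  \<comment> \<open>Taking \<open>m\<close> strictly between \<open>c\<close> and \<open>d\<close>
    keeps the closed intervals used below inside the range where \<open>T\<close> is differentiable,
    and puts \<open>c\<close> in the interior of \<open>{0<..<m}\<close>.\<close>
  define m where "m = (c + d) / 2"
  have m: "c < m" "m < d" "0 < m" using c d by (auto simp: m_def)
  \<comment> \<open>Since \<open>1 / z \<le> 1 / g z\<close>, the function \<open>T x + ln x\<close>
    is nonincreasing. So \<open>T\<close> tends to infinity at 0, which is why the solution never
    reaches 0 in finite time.\<close>
  have T_log: "T m + ln m \<le> T x + ln x" if x: "0 < x" "x \<le> m" for x
  proof (rule DERIV_nonpos_imp_nonincreasing[OF x(2)])
    fix z assume "x \<le> z" "z \<le> m"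
    then have z: "z \<in> {0<..<d}" using x m by auto
    then have "((\<lambda>x. T x + ln x) has_real_derivative - (1 / g z) + 1 / z) (at z)"
      by (auto intro!: derivative_eq_intros T')
    moreover have "1 / z \<le> 1 / g z" using pos[of z] le[of z] z d by (intro divide_left_mono) auto
    ultimately show "\<exists>l. ((\<lambda>x. T x + ln x) has_real_derivative l) (at z) \<and> l \<le> 0" by force
  qed
  have ex: "\<exists>x\<in>{0<..<d}. T x = s" if s: "T m < s" for s
  proof -
    \<comment> \<open>\<open>b\<close> is the value at time \<open>s\<close> of the solution of
      \<open>y' = - y\<close> that equals \<open>m\<close> at time \<open>T m\<close>. It falls at
      least as fast, so \<open>T b\<close> is at least \<open>s\<close> and the intermediate value
      theorem applies on \<open>{b..m}\<close>.\<close>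
    define b where "b = m * exp (T m - s)"
    have b: "0 < b" "b \<le> m" using m s by (auto simp: b_def)
    have "ln b = ln m + (T m - s)" using m by (simp add: b_def ln_mult)
    then have "s \<le> T b" using T_log[OF b] by simp
    moreover have "continuous_on {b..m} T"
      by (rule continuous_at_imp_continuous_on) (use b m in \<open>auto intro!: DERIV_isCont[OF T']\<close>)
    ultimately obtain x where "b \<le> x" "x \<le> m" "T x = s"
      using IVT2'[of T m s b] s b by auto
    then show ?thesis using b m by auto
  qed
  define Y where "Y s = (SOME x. x \<in> {0<..<d} \<and> T x = s)" for s
  have Y_ex: "Y s \<in> {0<..<d} \<and> T (Y s) = s" if "T m < s" for s
    unfolding Y_def by (rule someI_ex) (use ex[OF that] in blast)
  then have Y: "Y s \<in> {0<..<d}" "T (Y s) = s" if "T m < s" for s using that by blast+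
  have YT: "Y (T x) = x" if "0 < x" "x < m" for x
  proof -
    have "T m < T x" using that m by (intro Tdec) auto
    then show ?thesis using that m Y by (intro T_inj[of "Y (T x)" x]) auto
  qed
  have lt_m: "Y s < m" if "T m < s" for s
    using Tdec[of m "Y s"] Y[OF that] m that by (cases "Y s" m rule: linorder_cases) auto
  have Y': "(Y has_real_derivative - g (Y s)) (at s)" if s: "T m < s" for s
  proof -
    note Ys = Y[OF s] lt_m[OF s]
    have "isCont Y (T (Y s))"
    proof (rule isCont_inverse_function2[where f = T and a = "Y s / 2" and b = "(Y s + m) / 2"])
      fix z assume "Y s / 2 \<le> z" "z \<le> (Y s + m) / 2"
      then have z: "0 < z" "z < m" using Ys by auto
      then show "Y (T z) = z" by (rule YT)
      show "isCont T z" using z m by (intro DERIV_isCont[OF T']) auto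
    qed (use Ys in auto)
    then have "(Y has_real_derivative inverse (- (1 / g (Y s)))) (at s)"
      using pos[of "Y s"] Ys d s Y(2)
      by (intro DERIV_inverse_function[of T _ Y s "T m" "s + 1"] T') auto
    then show ?thesis by simp
  qed
  \<comment> \<open>As \<open>T\<close> decreases and \<open>c < m\<close>, the starting time
    \<open>T c\<close> lies strictly inside the domain of \<open>Y'\<close>, so the derivative is
    two-sided even at time 0.\<close>
  have Tc: "T m < T c" using c m by (intro Tdec) auto
  show ?thesis
  proof (intro exI[of _ "\<lambda>t. Y (t + T c)"] conjI allI impI)
    show "Y (0 + T c) = c" using YT c m by auto
    fix t :: real assume "0 \<le> t"
    then have t: "T m < t + T c" using Tc by simp
    show "Y (t + T c) \<in> {0<..<1}" using Y(1)[OF t] d by auto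
    show "((\<lambda>t. Y (t + T c)) has_real_derivative - g (Y (t + T c))) (at t)"
      using Y'[OF t] by (simp add: DERIV_shift)
  qed
qed

section \<open>Trajectories on the diagonal\<close>

lemma type_IV_field_diagonal:
  assumes "\<And>v. in_neighbors E v \<noteq> {}"
  shows "type_IV_field E f (\<chi> v. x) = (\<chi> v. f x - x)"
  using assms by (simp add: type_IV_field_def vec_eq_iff card_gt_0_iff)

text \<open>The scalar result applies to \<open>g x = x - f x\<close>: positivity is
  \<open>f x < x\<close>, and \<open>g x \<le> x\<close> is \<open>0 \<le> f x\<close>. All nodes
  then follow the same scalar solution.\<close>

lemma diagonal_trajectory:
  fixes E :: "('v::finite \<times> 'v) set"
  assumes nb: "\<And>v. in_neighbors E v \<noteq> {}"
    and f: "type_IV_combat_power f"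
    and c: "c \<in> {0<..<1}"
  shows "\<exists>B. trajectory state_space (type_IV_field E f) B \<and> B 0 = (\<chi> v. c)"
proof -
  note fD = type_IV_combat_powerD[OF f]
  have "\<exists>y. y 0 = c \<and> (\<forall>t\<ge>0. y t \<in> {0<..<1} \<and>
          (y has_real_derivative - (y t - f (y t))) (at t))"
  proof (rule separable_ode_solution[OF _ _ _ c])
    show "continuous_on {0<..<1} (\<lambda>x. x - f x)"
      by (intro continuous_intros continuous_on_subset[OF fD(2)]) auto
  qed (use fD(6,7) in auto)
  then obtain y where y: "y 0 = c" "\<And>t. 0 \<le> t \<Longrightarrow> y t \<in> {0<..<1}"
    "\<And>t. 0 \<le> t \<Longrightarrow> (y has_real_derivative f (y t) - y t) (at t)" by auto
  have "((\<lambda>t. \<chi> v::'v. y t) has_vector_derivative (\<chi> v. f (y t) - y t)) (at t within {0..})"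
    if "0 \<le> t" for t
  proof -
    define e :: "real ^ 'v" where "e = (\<chi> v. 1)"
    have vec: "(\<chi> v::'v. x) = x *\<^sub>R e" for x :: real by (simp add: vec_eq_iff e_def)
    have "(y has_vector_derivative f (y t) - y t) (at t within {0..})"
      using has_field_derivative_at_within[OF y(3)[OF that]]
      by (simp add: has_real_derivative_iff_has_vector_derivative)
    then show ?thesis
      unfolding vec by (rule bounded_linear.has_vector_derivative[OF bounded_linear_scaleR_left])
  qed
  then have "trajectory state_space (type_IV_field E f) (\<lambda>t. \<chi> v. y t)"
    unfolding trajectory_def type_IV_field_diagonal[OF nb] using y(2)
    by (auto simp: state_space_def less_imp_le)
  then show ?thesis using y(1) by auto
qed

section \<open>Convergence, stability at 0 and instability at 1\<close>

theorem theorem9: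
  fixes E :: "('v::finite \<times> 'v) set" and f :: "real \<Rightarrow> real"
  assumes "irrefl E"
    and "\<And>v. in_neighbors E v \<noteq> {}"
    and "type_IV_combat_power f"
  shows "(\<forall>B. trajectory state_space (type_IV_field E f) B \<and> (\<forall>v. B 0 $ v < 1) \<longrightarrow>
            (\<forall>v. ((\<lambda>t. B t $ v) \<longlongrightarrow> 0) at_top)) \<and>
         (equilibrium state_space (type_IV_field E f) (\<chi> v. 0) \<and>
          exponentially_stable state_space (type_IV_field E f) (\<chi> v. 0)) \<and>
         (equilibrium state_space (type_IV_field E f) (\<chi> v. 1) \<and>
          \<not> asymptotically_stable state_space (type_IV_field E f) (\<chi> v. 1))"
proof (intro conjI allI impI)
  note nb = assms(2) and f = assms(3)
  note fD = type_IV_combat_powerD[OF f]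
  show to_0: "((\<lambda>t. B t $ v) \<longlongrightarrow> 0) at_top"
    if B: "trajectory state_space (type_IV_field E f) B \<and> (\<forall>v. B 0 $ v < 1)" for B v
  proof -
    \<comment> \<open>With finitely many nodes the largest initial value is still below 1, and the
      midpoint of \<open>M\<close> and 1 lies strictly above all of them.\<close>
    define M where "M = Max (range (\<lambda>v. B 0 $ v))"
    have M: "B 0 $ v \<le> M" for v unfolding M_def by (intro Max_ge) auto
    have "M < 1" unfolding M_def using B by (subst Max_less_iff) auto
    moreover have "0 \<le> M" using M[of v] trajectory_component(1)[of E f B 0 v] B by simp
    ultimately have c: "0 < (1 + M) / 2" "(1 + M) / 2 < 1" and Mc: "M < (1 + M) / 2" by auto
    obtain r where r: "r > 0" "\<And>t. 0 \<le> t \<Longrightarrow> B t $ v \<le> (1 + M) / 2 * exp (- r * t)"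
      using trajectory_exponential_decay[OF nb f c] B le_less_trans[OF M Mc] by blast
    have "((\<lambda>t. (1 + M) / 2 * exp (- r * t)) \<longlongrightarrow> 0) at_top"
      using r(1) by (intro tendsto_mult_right_zero filterlim_compose[OF exp_at_bot]
          filterlim_tendsto_neg_mult_at_bot[OF tendsto_const _ filterlim_ident]) simp
    then show ?thesis
    proof (rule tendsto_sandwich[OF _ _ tendsto_const, rotated 2])
      show "\<forall>\<^sub>F t in at_top. 0 \<le> B t $ v"
        using eventually_ge_at_top[of 0] by eventually_elim (use B trajectory_component(1) in blast)
      show "\<forall>\<^sub>F t in at_top. B t $ v \<le> (1 + M) / 2 * exp (- r * t)"
        using eventually_ge_at_top[of 0] by eventually_elim (rule r(2))
    qed
  qed
  show "equilibrium state_space (type_IV_field E f) (\<chi> v. 0)"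
    "equilibrium state_space (type_IV_field E f) (\<chi> v. 1)"
    unfolding equilibrium_def type_IV_field_diagonal[OF nb]
    by (auto simp: state_space_def fD vec_eq_iff)
  show "exponentially_stable state_space (type_IV_field E f) (\<chi> v. 0)"
  proof -
    \<comment> \<open>The threshold 1/2 is an arbitrary choice of \<open>c\<close> in the open unit
      interval.\<close>
    define U where "U = state_space \<inter> (\<Inter>v. {x :: real ^ 'v. x $ v < 1/2})"
    have "openin (top_of_set state_space) U"
      unfolding U_def by (intro openin_open_Int open_INT ballI open_halfspace_component_lt_cart) auto
    moreover have "(\<chi> v. 0) \<in> U" by (auto simp: U_def state_space_def)
    moreover have "(B \<longlongrightarrow> (\<chi> v. 0)) at_top \<and>
        (\<exists>r>0. \<exists>M>0. \<forall>t\<ge>0. norm (B t - (\<chi> v. 0)) \<le> M * exp (- r * t))"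
      if B: "trajectory state_space (type_IV_field E f) B" "B 0 \<in> U" for B
    proof (intro conjI)
      have half: "B 0 $ v < 1/2" for v using B(2) by (auto simp: U_def)
      have "B 0 $ v < 1" for v using half[of v] by simp
      then show "(B \<longlongrightarrow> (\<chi> v. 0)) at_top"
        using to_0 B(1) by (intro vec_tendstoI) simp
      obtain r where r: "r > 0" "\<And>t v. 0 \<le> t \<Longrightarrow> B t $ v \<le> 1/2 * exp (- r * t)"
        using trajectory_exponential_decay[OF nb f, of "1/2"] B half by auto
      have "norm (B t - (\<chi> v. 0)) \<le> CARD('v) * (1/2) * exp (- r * t)" if t: "0 \<le> t" for t
      proof -
        have "norm (B t - (\<chi> v. 0)) \<le> (\<Sum>v\<in>UNIV. \<bar>B t $ v\<bar>)"
          using norm_le_l1_cart[of "B t - (\<chi> v. 0)"] by simp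
        also have "\<dots> \<le> (\<Sum>v\<in>(UNIV :: 'v set). 1/2 * exp (- r * t))"
          using r(2)[OF t] trajectory_component(1)[OF B(1) t] by (intro sum_mono) simp
        finally show ?thesis by simp
      qed
      then show "\<exists>r>0. \<exists>M>0. \<forall>t\<ge>0. norm (B t - (\<chi> v. 0)) \<le> M * exp (- r * t)"
        using r(1) by (intro exI[of _ r] conjI exI[of _ "CARD('v) * (1/2)"]) auto
    qed
    ultimately show ?thesis unfolding exponentially_stable_def by blast
  qed
  show "\<not> asymptotically_stable state_space (type_IV_field E f) (\<chi> v. 1)"
  proof
    assume "asymptotically_stable state_space (type_IV_field E f) (\<chi> v. 1)"
    then obtain U where U: "openin (top_of_set state_space) U" "(\<chi> v. 1) \<in> U"
      and conv: "\<And>B. trajectory state_space (type_IV_field E f) B \<Longrightarrow> B 0 \<in> U \<Longrightarrow>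
        (B \<longlongrightarrow> (\<chi> v. 1)) at_top"
      unfolding asymptotically_stable_def by blast
    from U(1) obtain W where W: "open W" "U = state_space \<inter> W" by (auto simp: openin_open)
    \<comment> \<open>The constant states tend to the all-ones state from below, so \<open>U\<close>
      contains one with value \<open>c < 1\<close>. Its trajectory tends to 0 by
      \<open>to_0\<close>, whereas stability would force the limit 1.\<close>
    have "((\<lambda>x. \<chi> v::'v. x) \<longlongrightarrow> (\<chi> v. (1::real))) (at_left 1)"
      by (intro tendsto_vec_lambda tendsto_ident_at)
    then have "\<forall>\<^sub>F x in at_left 1. (\<chi> v. x) \<in> W"
      using W U(2) by (auto dest: topological_tendstoD)
    moreover have "\<forall>\<^sub>F x in at_left (1::real). x \<in> {0<..<1}"
      by (rule eventually_at_leftI[of 0]) auto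
    ultimately have "\<forall>\<^sub>F x in at_left 1. (\<chi> v. x) \<in> W \<and> x \<in> {0<..<1}"
      by (rule eventually_conj)
    then obtain c :: real where c: "(\<chi> v. c) \<in> W" "c \<in> {0<..<1}"
      using eventually_happens[of _ "at_left (1::real)"] by auto
    obtain B where B: "trajectory state_space (type_IV_field E f) B" "B 0 = (\<chi> v. c)"
      using diagonal_trajectory[OF nb f c(2)] by blast
    have "B 0 \<in> U" using B(2) W(2) c by (auto simp: state_space_def)
    then have "((\<lambda>t. B t $ v) \<longlongrightarrow> 1) at_top" for v
      using tendsto_vec_nth[OF conv[OF B(1)], of v] by simp
    moreover have "((\<lambda>t. B t $ v) \<longlongrightarrow> 0) at_top" for v
      using to_0 B c(2) by auto
    ultimately have "(1::real) = 0" by (rule tendsto_unique[OF trivial_limit_at_top_linorder])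
    then show False by simp
  qed
qed

end
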